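(* The Bloch constant $B(1)$ and the Landau constant $L(1)$ for the class $\mathcal{M}_1(1)$ are infinite, i.e. $B(1)=L(1)=\infty$.
   Context: Let $\mathbb{D}=\{z\in\mathbb{C}:|z|<1\}$. For $\lambda\in\overline{\mathbb{D}}\setminus\{0\}$, $\mathcal{M}_1(\lambda)$ is the class of all meromorphic functions $f$ in $\mathbb{D}$ having a simple pole at $\lambda$, analytic at all other points of $\mathbb{D}$, and normalized by $f'(0)=1$. In particular, for $\lambda\in\partial\mathbb{D}$ the function $f$ is analytic in all of $\mathbb{D}$, and having a simple pole at $\lambda$ means that near $\lambda$ one has $f(z)=h(z)/(z-\lambda)$ with $h$ analytic at $\lambda$ and $h(\lambda)\neq 0$. For $f\in\mathcal{M}_1(\lambda)$, $L_f(\lambda)$ is the radius of the largest disk contained in $f(\mathbb{D})$, i.e. the supremum in $[0,\infty]$ of the radii of open Euclidean disks in $\mathbb{C}$ contained in $f(\mathbb{D})$. $B_f(\lambda)$ is the radius of the largest schlicht disk contained in $f(\mathbb{D})$, i.e. the supremum in $[0,\infty]$ of the radii of schlicht disks, where a schlicht disk is an open Euclidean disk $\Delta\subset\mathbb{C}$ for which there is a subdomain $U\subset\mathbb{D}$ such that $f$ is univalent on $U$ and $f(U)=\Delta$. The Landau and Bloch constants of the class are $L(\lambda)=\inf\{L_f(\lambda):f\in\mathcal{M}_1(\lambda)\}$ and $B(\lambda)=\inf\{B_f(\lambda):f\in\mathcal{M}_1(\lambda)\}$. *)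

theory Defs
  imports "HOL-Complex_Analysis.Complex_Analysis"
begin

abbreviation unit_disk :: "complex set"
  where "unit_disk \<equiv> ball 0 1"

(* p may lie on the unit circle, where f carries no information outside the disk; the
   local representation is therefore only required for z in the disk. For p inside the disk
   the filter is the full punctured neighbourhood filter, and this is an ordinary simple
   pole. *)
definition simple_pole_at :: "(complex \<Rightarrow> complex) \<Rightarrow> complex \<Rightarrow> bool"
  where "simple_pole_at f p \<longleftrightarrow>
    (\<exists>h. h analytic_on {p} \<and> h p \<noteq> 0 \<and>
         (\<forall>\<^sub>F z in at p within unit_disk. f z = h z / (z - p)))"

(* Meant for p in cball 0 1 - {0}. Members are total functions of which only the values on
   unit_disk - {p} matter. *)
definition M1 :: "complex \<Rightarrow> (complex \<Rightarrow> complex) set"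
  where "M1 p = {f. f holomorphic_on (unit_disk - {p}) \<and> simple_pole_at f p \<and> deriv f 0 = 1}"

(* For p in the unit disk the value of f at p is the point at infinity, which lies in no
   Euclidean disk; hence p is removed (its HOL value is arbitrary). *)
definition landau_radius :: "complex \<Rightarrow> (complex \<Rightarrow> complex) \<Rightarrow> ennreal"
  where "landau_radius p f =
    Sup {ennreal r |r. 0 < r \<and> (\<exists>c. ball c r \<subseteq> f ` (unit_disk - {p}))}"

definition schlicht_disk :: "complex \<Rightarrow> (complex \<Rightarrow> complex) \<Rightarrow> complex \<Rightarrow> real \<Rightarrow> bool"
  where "schlicht_disk p f c r \<longleftrightarrow> 0 < r \<and>
    (\<exists>U. open U \<and> connected U \<and> U \<noteq> {} \<and> U \<subseteq> unit_disk - {p} \<and> inj_on f U \<and> f ` U = ball c r)"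

definition bloch_radius :: "complex \<Rightarrow> (complex \<Rightarrow> complex) \<Rightarrow> ennreal"
  where "bloch_radius p f = Sup {ennreal r |r. \<exists>c. schlicht_disk p f c r}"

definition landau_const :: "complex \<Rightarrow> ennreal"
  where "landau_const p = (INF f\<in>M1 p. landau_radius p f)"

definition bloch_const :: "complex \<Rightarrow> ennreal"
  where "bloch_const p = (INF f\<in>M1 p. bloch_radius p f)"

end

theory Submission imports Defs begin

text \<open>
  A simple pole at the boundary point \<open>1\<close> forces arbitrarily large schlicht disks.
  Subtracting the principal part gives
  \<open>f z = a / (z - 1) + k z\<close> in the disk near \<open>1\<close>, with \<open>a \<noteq> 0\<close> and \<open>k\<close> analytic at \<open>1\<close>.
  The coordinate \<open>u = 1 / (z - 1)\<close> turns the unit disk into the half-plane \<open>Re u < - 1/2\<close> and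
  sends \<open>1\<close> to infinity, so that \<open>f\<close> becomes \<open>u \<mapsto> a * u + k (1 + 1 / u)\<close>. The second summand has
  Lipschitz constant \<open>O(1 / \<rho>\<^sup>2)\<close> on the disk of centre \<open>- 2 * \<rho>\<close> and radius \<open>\<rho>\<close>, which lies in
  the half-plane for \<open>\<rho> \<ge> 1\<close> (\<open>nearly_linear_near_boundary_pole\<close>). For large \<open>\<rho>\<close> the function is therefore a
  small Lipschitz perturbation of \<open>u \<mapsto> a * u\<close>, and the contraction principle inverts it over a
  disk of radius \<open>norm a * \<rho> / 2\<close> (\<open>lipschitz_perturbation_right_inverse\<close>). This disk is schlicht,
  and \<open>\<rho>\<close> is arbitrary. As a schlicht disk lies in the image, the Landau radius is infinite too.
\<close>

text \<open>
  The solution of \<open>a * u + \<phi> u = w\<close> is the fixed point of \<open>u \<mapsto> (w - \<phi> u) / a\<close>, which halves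
  distances. The loss of one half in the radius of the target disk is what makes this map preserve
  a closed disk around \<open>c\<close>. The inverse is continuous because \<open>u \<mapsto> a * u + \<phi> u\<close> shrinks
  distances at most by the factor \<open>norm a / 2\<close>.
\<close>
lemma lipschitz_perturbation_right_inverse:
  fixes \<phi> :: "complex \<Rightarrow> complex"
  assumes a: "a \<noteq> 0"
    and lip: "(norm a / 2)-lipschitz_on (ball c \<rho>) \<phi>"
  obtains g where "continuous_on (ball (a * c + \<phi> c) (norm a * \<rho> / 2)) g"
    and "g ` ball (a * c + \<phi> c) (norm a * \<rho> / 2) \<subseteq> ball c \<rho>"
    and "\<And>w. w \<in> ball (a * c + \<phi> c) (norm a * \<rho> / 2) \<Longrightarrow> a * g w + \<phi> (g w) = w"
proof -
  define B where "B = ball (a * c + \<phi> c) (norm a * \<rho> / 2)"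
  have na: "norm a > 0" using a by simp
  have lipD: "norm (\<phi> x - \<phi> y) \<le> norm a / 2 * norm (x - y)"
    if "x \<in> ball c \<rho>" "y \<in> ball c \<rho>" for x y
    using lipschitz_onD[OF lip that] by (simp add: dist_norm)
  have "\<exists>u\<in>ball c \<rho>. a * u + \<phi> u = w" if w: "w \<in> B" for w
  proof -
    \<comment> \<open>the least radius at which contraction by one half keeps the closed disk inside itself\<close>
    define s where "s = 2 * norm (w - (a * c + \<phi> c)) / norm a"
    have s: "0 \<le> s" "s < \<rho>"
      using w na by (auto simp: s_def B_def dist_norm norm_minus_commute field_simps)
    have sub: "cball c s \<subseteq> ball c \<rho>" using s by auto
    define T where "T u = (w - \<phi> u) / a" for u
    have T_dist: "dist (T x) (T y) \<le> 1/2 * dist x y" if "x \<in> cball c s" "y \<in> cball c s" for x y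
    proof -
      have "T x - T y = - (\<phi> x - \<phi> y) / a" by (simp add: T_def diff_divide_distrib)
      then have "dist (T x) (T y) = norm (\<phi> x - \<phi> y) / norm a"
        by (simp add: dist_norm norm_divide norm_minus_commute)
      also have "\<dots> \<le> (norm a / 2 * norm (x - y)) / norm a"
        using lipD[OF subsetD[OF sub] subsetD[OF sub]] that by (intro divide_right_mono) simp_all
      finally show ?thesis using na by (simp add: dist_norm)
    qed
    have "T ` cball c s \<subseteq> cball c s"
    proof (rule image_subsetI)
      fix u assume u: "u \<in> cball c s"
      have "T c - c = (w - (a * c + \<phi> c)) / a" using a by (simp add: T_def field_simps)
      then have "dist (T c) c = s / 2" using na by (simp add: dist_norm s_def norm_divide)
      moreover have "dist (T u) (T c) \<le> s / 2" using T_dist[of u c] u s by (simp add: dist_commute)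
      ultimately have "dist (T u) c \<le> s" using dist_triangle[of "T u" c "T c"] by linarith
      then show "T u \<in> cball c s" by (simp add: dist_commute)
    qed
    then have "\<exists>!u\<in>cball c s. T u = u"
      using s by (intro Banach_fix[where c = "1/2"] T_dist) (auto simp: complete_eq_closed)
    then obtain u where "u \<in> cball c s" "T u = u" by blast
    then show ?thesis using sub a by (auto simp: T_def field_simps intro!: bexI[of _ u])
  qed
  then obtain g where g: "\<And>w. w \<in> B \<Longrightarrow> g w \<in> ball c \<rho> \<and> a * g w + \<phi> (g w) = w" by metis
  have "(2 / norm a)-lipschitz_on B g"
  proof (rule lipschitz_onI)
    fix v w assume vw: "v \<in> B" "w \<in> B"
    have "v - w = (a * g v + \<phi> (g v)) - (a * g w + \<phi> (g w))"
      using g vw by simp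
    then have "a * (g v - g w) = (v - w) - (\<phi> (g v) - \<phi> (g w))"
      by (simp only: right_diff_distrib) simp
    then have "norm a * norm (g v - g w) \<le> norm (v - w) + norm (\<phi> (g v) - \<phi> (g w))"
      by (metis norm_mult norm_triangle_ineq4)
    also have "\<dots> \<le> norm (v - w) + norm a / 2 * norm (g v - g w)"
      using lipD g vw by simp
    finally show "dist (g v) (g w) \<le> 2 / norm a * dist v w"
      using na by (simp add: dist_norm field_simps)
  qed (use na in simp)
  then have "continuous_on B g" by (rule lipschitz_on_continuous_on)
  with g show thesis by (intro that) (auto simp: B_def)
qed

text \<open>
  A continuous section is injective, so by invariance of domain its image is an open set, on which
  \<open>f\<close> is inverted by the section.
\<close>
lemma schlicht_disk_if_continuous_section:
  assumes "0 < r" and cont: "continuous_on (ball c r) \<psi>"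
    and sub: "\<psi> ` ball c r \<subseteq> unit_disk - {p}"
    and sect: "\<And>w. w \<in> ball c r \<Longrightarrow> f (\<psi> w) = w"
  shows "schlicht_disk p f c r"
proof -
  have "inj_on \<psi> (ball c r)" by (metis inj_onI sect)
  then have "open (\<psi> ` ball c r)" using invariance_of_domain cont by blast
  moreover have "connected (\<psi> ` ball c r)" using cont by (intro connected_continuous_image) auto
  moreover have "inj_on f (\<psi> ` ball c r)" using sect by (auto intro!: inj_onI)
  moreover have "f ` \<psi> ` ball c r = ball c r" using sect by (force simp: image_image)
  ultimately show ?thesis
    unfolding schlicht_disk_def using \<open>0 < r\<close> sub
    by (intro conjI exI[of _ "\<psi> ` ball c r"]) auto
qed

text \<open>
  The difference quotient of the numerator of \<open>f\<close> is analytic at the pole, hence Lipschitz near it.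
\<close>
lemma simple_pole_at_decompose:
  assumes "simple_pole_at f p"
  obtains a k \<delta> L where "a \<noteq> 0" "0 < \<delta>" "L-lipschitz_on (cball p \<delta>) k"
    and "\<And>z. z \<in> unit_disk \<Longrightarrow> z \<noteq> p \<Longrightarrow> dist z p \<le> \<delta> \<Longrightarrow> f z = a / (z - p) + k z"
proof -
  obtain h where h: "h analytic_on {p}" "h p \<noteq> 0"
    and ev: "\<forall>\<^sub>F z in at p within unit_disk. f z = h z / (z - p)"
    using assms unfolding simple_pole_at_def by blast
  obtain d where d: "d > 0" "\<And>z. z \<in> unit_disk \<Longrightarrow> z \<noteq> p \<Longrightarrow> dist z p < d \<Longrightarrow> f z = h z / (z - p)"
    using ev unfolding eventually_at by auto
  obtain e where e: "e > 0" "h holomorphic_on ball p e"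
    using h(1) unfolding analytic_on_def by auto
  define k where "k z = (if z = p then deriv h p else (h z - h p) / (z - p))" for z
  have hol: "k holomorphic_on ball p e"
    unfolding k_def[abs_def] using e by (intro pole_lemma) auto
  define \<delta> where "\<delta> = min d e / 2"
  have \<delta>: "\<delta> > 0" "\<delta> < d" "\<delta> < e" using d e by (auto simp: \<delta>_def)
  have sub: "cball p \<delta> \<subseteq> ball p e" using \<delta> by auto
  have "continuous_on (cball p \<delta>) (deriv k)"
    using hol sub by (meson holomorphic_deriv holomorphic_on_imp_continuous_on holomorphic_on_subset open_ball)
  then have "bounded (deriv k ` cball p \<delta>)"
    by (intro compact_imp_bounded compact_continuous_image) auto
  then obtain L where L: "\<And>z. z \<in> cball p \<delta> \<Longrightarrow> norm (deriv k z) \<le> L"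
    unfolding bounded_iff by blast
  have "L-lipschitz_on (cball p \<delta>) k"
  proof (rule lipschitz_onI)
    fix x y assume xy: "x \<in> cball p \<delta>" "y \<in> cball p \<delta>"
    show "dist (k x) (k y) \<le> L * dist x y"
      unfolding dist_norm
    proof (rule field_differentiable_bound[OF convex_cball])
      fix z assume "z \<in> cball p \<delta>"
      then show "(k has_field_derivative deriv k z) (at z within cball p \<delta>)"
        using hol sub by (meson has_field_derivative_at_within holomorphic_derivI open_ball subsetD)
    qed (use L xy in auto)
  next
    show "0 \<le> L" using order_trans[OF norm_ge_zero L[of p]] \<delta> by simp
  qed
  moreover have "f z = h p / (z - p) + k z" if "z \<in> unit_disk" "z \<noteq> p" "dist z p \<le> \<delta>" for z
    using d(2)[of z] that \<delta> by (simp add: k_def diff_divide_distrib)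
  ultimately show thesis using h(2) \<delta>(1) by (intro that)
qed

text \<open>
  Since \<open>1 / u - 1 / v = (v - u) / (u * v)\<close>, the coordinate change contributes the factor
  \<open>1 / \<rho>\<^sup>2\<close> to the Lipschitz constant of the analytic part of \<open>f\<close>. Disks with centre \<open>- 2 * \<rho>\<close>
  serve because they keep the distance \<open>\<rho>\<close> from \<open>0\<close> while their radius still grows without bound.
\<close>
lemma nearly_linear_near_boundary_pole:
  assumes "simple_pole_at f 1"
  obtains a \<phi> R where "a \<noteq> 0"
    and "\<And>\<rho>. R \<le> \<rho> \<Longrightarrow> (norm a / 2)-lipschitz_on (ball (- 2 * of_real \<rho>) \<rho>) \<phi>"
    and "\<And>\<rho> u. R \<le> \<rho> \<Longrightarrow> u \<in> ball (- 2 * of_real \<rho>) \<rho> \<Longrightarrow>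
      u \<noteq> 0 \<and> 1 + 1 / u \<in> unit_disk \<and> f (1 + 1 / u) = a * u + \<phi> u"
proof -
  obtain a k \<delta> L where a: "a \<noteq> 0" and \<delta>: "0 < \<delta>" and lip: "L-lipschitz_on (cball 1 \<delta>) k"
    and f: "\<And>z. z \<in> unit_disk \<Longrightarrow> z \<noteq> 1 \<Longrightarrow> dist z 1 \<le> \<delta> \<Longrightarrow> f z = a / (z - 1) + k z"
    by (rule simple_pole_at_decompose[OF assms]) (rule that)
  define R where "R = max 1 (max (1 / \<delta>) (2 * L / norm a))"
  have L: "0 \<le> L" using lip by (rule lipschitz_on_nonneg)
  have region: "u \<noteq> 0 \<and> \<rho> \<le> norm u \<and> 1 + 1 / u \<in> unit_disk \<and> 1 + 1 / u \<in> cball 1 \<delta>"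
    if \<rho>: "R \<le> \<rho>" and u: "u \<in> ball (- 2 * of_real \<rho>) \<rho>" for \<rho> u
  proof -
    have \<rho>1: "1 \<le> \<rho>" and \<rho>\<delta>: "1 / \<delta> \<le> \<rho>" using \<rho> by (auto simp: R_def)
    have "norm (u + 2 * of_real \<rho>) < \<rho>" using u by (simp add: dist_norm norm_minus_commute)
    then have "\<bar>Re u + 2 * \<rho>\<bar> < \<rho>" using abs_Re_le_cmod[of "u + 2 * of_real \<rho>"] by simp
    then have Re: "Re u < - \<rho>" by linarith
    then have nu: "\<rho> \<le> norm u" using abs_Re_le_cmod[of u] by linarith
    then have u0: "u \<noteq> 0" using \<rho>1 by auto
    have "norm (u + 1) < norm u"
      unfolding cmod_def using Re \<rho>1
      by (intro real_sqrt_less_mono) (simp add: power2_eq_square algebra_simps)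
    moreover have "1 + 1 / u = (u + 1) / u" using u0 by (simp add: field_simps)
    ultimately have "1 + 1 / u \<in> unit_disk" using u0 by (simp add: norm_divide)
    moreover have "1 / norm u \<le> \<delta>"
    proof -
      have "1 / \<delta> \<le> norm u" using \<rho>\<delta> nu by linarith
      then show ?thesis using \<delta> u0 by (simp add: field_simps)
    qed
    then have "1 + 1 / u \<in> cball 1 \<delta>" by (simp add: dist_norm norm_divide)
    ultimately show ?thesis using u0 nu by blast
  qed
  define \<phi> where "\<phi> u = k (1 + 1 / u)" for u
  have "(norm a / 2)-lipschitz_on (ball (- 2 * of_real \<rho>) \<rho>) \<phi>" if \<rho>: "R \<le> \<rho>" for \<rho>
  proof (rule lipschitz_onI)
    fix u v :: complex
    assume uv: "u \<in> ball (- 2 * of_real \<rho>) \<rho>" "v \<in> ball (- 2 * of_real \<rho>) \<rho>"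
    note u = region[OF \<rho> uv(1)] and v = region[OF \<rho> uv(2)]
    have \<rho>1: "1 \<le> \<rho>" and \<rho>L: "2 * L / norm a \<le> \<rho>" using \<rho> by (auto simp: R_def)
    have "\<rho> * 1 \<le> norm u * norm v" using u v \<rho>1 by (intro mult_mono) auto
    then have "2 * L / norm a \<le> norm u * norm v" using \<rho>L by linarith
    then have bound: "L / (norm u * norm v) \<le> norm a / 2" using a u v by (simp add: field_simps)
    have "(1 + 1 / u) - (1 + 1 / v) = (v - u) / (u * v)" using u v by (simp add: field_simps)
    then have "dist (1 + 1 / u) (1 + 1 / v) = dist u v / (norm u * norm v)"
      by (simp add: dist_norm norm_divide norm_mult norm_minus_commute)
    then have "dist (\<phi> u) (\<phi> v) \<le> L / (norm u * norm v) * dist u v"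
      using lipschitz_onD[OF lip, of "1 + 1 / u" "1 + 1 / v"] u v by (simp add: \<phi>_def)
    also have "\<dots> \<le> norm a / 2 * dist u v" using bound by (intro mult_right_mono) auto
    finally show "dist (\<phi> u) (\<phi> v) \<le> norm a / 2 * dist u v" .
  qed simp
  moreover have "u \<noteq> 0 \<and> 1 + 1 / u \<in> unit_disk \<and> f (1 + 1 / u) = a * u + \<phi> u"
    if "R \<le> \<rho>" "u \<in> ball (- 2 * of_real \<rho>) \<rho>" for \<rho> u
    using region[OF that] f[of "1 + 1 / u"] by (simp add: \<phi>_def dist_commute)
  ultimately show thesis using a by (intro that)
qed

lemma large_schlicht_disk_near_boundary_pole:
  assumes "simple_pole_at f 1"
  shows "\<exists>r>N. \<exists>c. schlicht_disk 1 f c r"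
proof -
  obtain a \<phi> R where a: "a \<noteq> 0"
    and lip: "\<And>\<rho>. R \<le> \<rho> \<Longrightarrow> (norm a / 2)-lipschitz_on (ball (- 2 * of_real \<rho>) \<rho>) \<phi>"
    and f: "\<And>\<rho> u. R \<le> \<rho> \<Longrightarrow> u \<in> ball (- 2 * of_real \<rho>) \<rho> \<Longrightarrow>
      u \<noteq> 0 \<and> 1 + 1 / u \<in> unit_disk \<and> f (1 + 1 / u) = a * u + \<phi> u"
    by (rule nearly_linear_near_boundary_pole[OF assms]) (rule that)
  define \<rho> where "\<rho> = max (max R 1) (2 * (N + 1) / norm a)"
  define r where "r = norm a * \<rho> / 2"
  define c :: complex where "c = - 2 * of_real \<rho>"
  have \<rho>: "R \<le> \<rho>" "1 \<le> \<rho>" "2 * (N + 1) / norm a \<le> \<rho>" by (auto simp: \<rho>_def)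
  have "N < r"
  proof -
    have "N + 1 \<le> r" using \<rho>(3) a by (simp add: r_def field_simps)
    then show ?thesis by simp
  qed
  have "0 < r" using a \<rho> by (simp add: r_def)
  obtain g where g: "continuous_on (ball (a * c + \<phi> c) r) g"
      "g ` ball (a * c + \<phi> c) r \<subseteq> ball c \<rho>"
      "\<And>w. w \<in> ball (a * c + \<phi> c) r \<Longrightarrow> a * g w + \<phi> (g w) = w"
    by (rule lipschitz_perturbation_right_inverse[OF a lip[OF \<rho>(1)], folded c_def r_def]) (rule that)
  have fg: "g w \<noteq> 0 \<and> 1 + 1 / g w \<in> unit_disk \<and> f (1 + 1 / g w) = w"
    if "w \<in> ball (a * c + \<phi> c) r" for w
    using f[OF \<rho>(1), folded c_def, OF subsetD[OF g(2) imageI[OF that]]] g(3)[OF that] by simp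
  have "schlicht_disk 1 f (a * c + \<phi> c) r"
  proof (rule schlicht_disk_if_continuous_section)
    show "continuous_on (ball (a * c + \<phi> c) r) (\<lambda>w. 1 + 1 / g w)"
      using fg by (intro continuous_intros g(1)) blast
    show "(\<lambda>w. 1 + 1 / g w) ` ball (a * c + \<phi> c) r \<subseteq> unit_disk - {1}"
      using fg by fastforce
  qed (use fg \<open>0 < r\<close> in auto)
  then show ?thesis using \<open>N < r\<close> by blast
qed

lemma bloch_radius_le_landau_radius: "bloch_radius p f \<le> landau_radius p f"
  unfolding bloch_radius_def landau_radius_def
proof (rule Sup_subset_mono, clarify)
  fix r c assume "schlicht_disk p f c r"
  then show "\<exists>r'. ennreal r = ennreal r' \<and> 0 < r' \<and> (\<exists>c. ball c r' \<subseteq> f ` (unit_disk - {p}))"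
    unfolding schlicht_disk_def by (metis image_mono)
qed

lemma bloch_radius_boundary_pole:
  assumes "simple_pole_at f 1"
  shows "bloch_radius 1 f = \<infinity>"
proof (rule ccontr)
  assume "bloch_radius 1 f \<noteq> \<infinity>"
  then obtain N where N: "bloch_radius 1 f = ennreal N" "0 \<le> N"
    by (cases "bloch_radius 1 f") auto
  obtain r c where r: "r > N" "schlicht_disk 1 f c r"
    using large_schlicht_disk_near_boundary_pole[OF assms] by blast
  have "ennreal r \<le> bloch_radius 1 f"
    unfolding bloch_radius_def using r by (intro Sup_upper) auto
  with N r show False by simp
qed

theorem corollary2p1:
  shows "bloch_const 1 = \<infinity> \<and> landau_const 1 = \<infinity>"
proof -
  have bloch: "bloch_radius 1 f = \<infinity>" if "f \<in> M1 1" for f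
    using that bloch_radius_boundary_pole by (simp add: M1_def)
  moreover have "landau_radius 1 f = \<infinity>" if "f \<in> M1 1" for f
    using bloch_radius_le_landau_radius[of 1 f] bloch[OF that] by (simp add: top_unique)
  ultimately show ?thesis by (simp add: bloch_const_def landau_const_def)
qed

end
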